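(* Let $a_x,b_x,c_x,\gamma_x>0$, $a_y,b_y,c_y,\gamma_y>0$ and $\theta>0$. Let $X$ and $Y$ be independent random variables, where $X$ has the rGB1-IWei distribution with parameters $(\gamma_x,\theta,a_x,b_x,c_x)$ and $Y$ has the rGB1-IWei distribution with parameters $(\gamma_y,\theta,a_y,b_y,c_y)$. Then the reliability $R=P(Y<X)$ is given by $$R=\frac{c_xc_y}{B(a_x,b_x)B(a_y,b_y)}\sum_{j_1=0}^{\infty}\sum_{j_2=0}^{\infty}\sum_{j_3=0}^{\infty}\sum_{j_4=0}^{\infty}\frac{p_{j_1,b_y}\;p_{j_2,c_y(a_y+j_1)}\;p_{j_3,b_x}\;p_{j_4,c_x(a_x+j_3)}\;\gamma_x(j_4+1)}{(j_2+1)(j_4+1)\left[\gamma_x(j_4+1)+\gamma_y(j_2+1)\right]}.$$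
   Context: $\Gamma$ is the Gamma function and $B(a,b)=\Gamma(a)\Gamma(b)/\Gamma(a+b)$ the Beta function. A positive random variable has the rGB1-IWei (reflected generalized beta of first type Inverse Weibull) distribution with parameters $(\gamma,\theta,a,b,c)$, all positive, if it has the density, for $x>0$, $$f(x)=\frac{c\,\gamma\,\theta\,x^{-\theta-1}e^{-\gamma x^{-\theta}}}{B(a,b)}\left[1-e^{-\gamma x^{-\theta}}\right]^{ac-1}\left(1-\left[1-e^{-\gamma x^{-\theta}}\right]^{c}\right)^{b-1}.$$ For a real number $s$ and an integer $j\ge 0$, $p_{j,s}=\dfrac{(-1)^j\,\Gamma(s)}{\Gamma(s-j)\,\Gamma(j+1)}$, understood as $(-1)^j\binom{s-1}{j}$ (with $\binom{s-1}{j}=\frac{(s-1)(s-2)\cdots(s-j)}{j!}$), which gives the value when the Gamma functions have poles. The multiple series is an iterated sum, with the sum over $j_4$ innermost, then $j_3$, then $j_2$, then $j_1$. *)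

theory Defs
  imports "HOL-Probability.Probability"
begin

definition rGB1_IWei_density ::
    "real \<Rightarrow> real \<Rightarrow> real \<Rightarrow> real \<Rightarrow> real \<Rightarrow> real \<Rightarrow> real" where
  "rGB1_IWei_density \<gamma> \<theta> a b c x =
     (if x > 0 then
        c * \<gamma> * \<theta> * x powr (- \<theta> - 1) * exp (- \<gamma> * x powr (- \<theta>)) / Beta a b
          * (1 - exp (- \<gamma> * x powr (- \<theta>))) powr (a * c - 1)
          * (1 - (1 - exp (- \<gamma> * x powr (- \<theta>))) powr c) powr (b - 1)
      else 0)"

definition has_rGB1_IWei_distribution ::
    "'w measure \<Rightarrow> ('w \<Rightarrow> real) \<Rightarrow> real \<Rightarrow> real \<Rightarrow> real \<Rightarrow> real \<Rightarrow> real \<Rightarrow> bool" where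
  "has_rGB1_IWei_distribution M X \<gamma> \<theta> a b c \<longleftrightarrow>
     distributed M lborel X (\<lambda>x. ennreal (rGB1_IWei_density \<gamma> \<theta> a b c x))"

text \<open>The quotient $(-1)^j \Gamma(s) / (\Gamma(s-j) \Gamma(j+1))$, continued to the
  integers \<open>s\<close> where the Gamma functions have poles.\<close>

definition p_coeff :: "nat \<Rightarrow> real \<Rightarrow> real" where
  "p_coeff j s = (- 1) ^ j * ((s - 1) gchoose j)"

end

theory Submission
  imports Defs
begin

text \<open>Put $U = e^{-\gamma_x X^{-\theta}}$ and $V = e^{-\gamma_y Y^{-\theta}}$. Both have a density
  $\frac{c}{B(a,b)} (1-u)^{ac-1} (1-(1-u)^c)^{b-1}$ on $(0,1)$, and $Y < X$ means $V < U^\rho$ with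
  $\rho = \gamma_y/\gamma_x$. The rational factor of the series is
  $\int\!\int_{0 < v < u^\rho < 1} u^{j_4} v^{j_2}\,dv\,du$. Each of the four summations
  is then an instance of $\sum_j p_{j,s} z^j = (1-z)^{s-1}$ under this integral, with
  $z = u$, $(1-u)^{c_x}$, $v$ and $(1-v)^{c_y}$ in turn. Sum and integral commute by dominated
  convergence: the signs of $p_{j,s}$ are constant from some index on, so that
  $\sum_j |p_{j,s}| z^j \le C_s + (1-z)^{s-1}$ for $0 \le z < 1$.\<close>

section \<open>The coefficients p_{j,s} and bounds for their power series\<close>

lemma p_coeff_sums:
  fixes z s :: real
  assumes "\<bar>z\<bar> < 1"
  shows "(\<lambda>j. p_coeff j s * z ^ j) sums (1 - z) powr (s - 1)"
proof -
  have "(\<lambda>j. ((s - 1) gchoose j) * (- z) ^ j) sums (1 + - z) powr (s - 1)"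
    using assms by (intro gen_binomial_real) simp
  then show ?thesis
    by (simp add: p_coeff_def power_minus[of z] mult_ac)
qed

text \<open>The ratio of consecutive coefficients is nonnegative once j + 1 >= s, so the sign can no
  longer change from there on.\<close>

lemma p_coeff_Suc: "p_coeff (Suc j) s = p_coeff j s * ((real j + 1 - s) / (real j + 1))"
proof -
  have "((s - 1) gchoose Suc j) * (real j + 1) = (s - 1 - real j) * ((s - 1) gchoose j)"
    using gbinomial_mult_1[of "s - 1" j] by (simp add: algebra_simps)
  then have "((s - 1) gchoose Suc j) = (s - 1 - real j) * ((s - 1) gchoose j) / (real j + 1)"
    by (simp add: field_simps)
  then have "p_coeff (Suc j) s = (- 1) ^ Suc j * ((s - 1 - real j) * ((s - 1) gchoose j) / (real j + 1))"
    by (simp only: p_coeff_def)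
  also have "\<dots> = (- 1) ^ j * ((s - 1) gchoose j) * ((real j + 1 - s) / (real j + 1))"
    by (simp add: divide_simps) (simp add: algebra_simps)
  finally show ?thesis
    by (simp only: p_coeff_def)
qed

lemma p_coeff_eventually_abs:
  obtains N \<epsilon> where "\<bar>\<epsilon>\<bar> = (1::real)" "\<And>j. j \<ge> N \<Longrightarrow> \<bar>p_coeff j s\<bar> = \<epsilon> * p_coeff j s"
proof -
  \<comment> \<open>For j >= \<open>N\<close> one has s <= j, so the ratio in
    \<open>p_coeff_Suc\<close> is nonnegative and the sign found at \<open>N\<close> persists. If s
    is a positive integer, all these coefficients vanish and either sign would do.\<close>
  define N where "N = nat \<lceil>s\<rceil>"
  define \<epsilon> :: real where "\<epsilon> = (if p_coeff N s \<ge> 0 then 1 else -1)"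
  have "0 \<le> \<epsilon> * p_coeff j s" if "j \<ge> N" for j
    using that
  proof (induction j rule: dec_induct)
    case base
    then show ?case by (simp add: \<epsilon>_def)
  next
    case (step j)
    then have "s \<le> real j"
      unfolding N_def by linarith
    then have "0 \<le> (\<epsilon> * p_coeff j s) * ((real j + 1 - s) / (real j + 1))"
      using step.IH by (intro mult_nonneg_nonneg[of "\<epsilon> * p_coeff j s"]) auto
    then show ?case
      by (simp add: p_coeff_Suc mult_ac)
  qed
  moreover have "\<bar>\<epsilon>\<bar> = 1"
    by (simp add: \<epsilon>_def)
  ultimately show ?thesis
    using that[of \<epsilon> N] by (metis abs_mult abs_of_nonneg mult_1)
qed

text \<open>Only finitely many signs differ from \<epsilon>, so the series of absolute values is
  \<epsilon> (1 - z)^(s - 1) plus a polynomial. The constant \<open>C\<close> is uniform in z and n;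
  the power of 1 - z has to stay in the bound because it is unbounded near z = 1 when s < 1.\<close>

lemma p_coeff_abs_partial_sum_le:
  obtains C where "\<And>z n. 0 \<le> z \<Longrightarrow> z < 1 \<Longrightarrow>
    (\<Sum>j<n. \<bar>p_coeff j s\<bar> * z ^ j) \<le> C + (1 - z) powr (s - 1)"
proof -
  obtain N \<epsilon> where \<epsilon>: "\<bar>\<epsilon>\<bar> = (1::real)"
    and N: "\<And>j. j \<ge> N \<Longrightarrow> \<bar>p_coeff j s\<bar> = \<epsilon> * p_coeff j s"
    using p_coeff_eventually_abs[of s] by blast
  \<comment> \<open>The correction for the wrong signs: \<open>d j\<close> is nonnegative and
    vanishes for j >= \<open>N\<close>, so its power series is a polynomial, bounded on [0, 1) by
    the sum of its coefficients.\<close>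
  define d where "d j = \<bar>p_coeff j s\<bar> - \<epsilon> * p_coeff j s" for j
  have d: "0 \<le> d j" for j
    using abs_ge_self[of "\<epsilon> * p_coeff j s"] \<epsilon> by (simp add: d_def abs_mult)
  show thesis
  proof
    fix z :: real and n assume z: "0 \<le> z" "z < 1"
    have "(\<lambda>j. d j * z ^ j) sums (\<Sum>j<N. d j * z ^ j)"
      using N by (intro sums_finite) (auto simp: d_def)
    then have "(\<lambda>j. \<epsilon> * (p_coeff j s * z ^ j) + d j * z ^ j) sums
        (\<epsilon> * (1 - z) powr (s - 1) + (\<Sum>j<N. d j * z ^ j))"
      using z by (intro sums_add sums_mult p_coeff_sums) auto
    then have "(\<lambda>j. \<bar>p_coeff j s\<bar> * z ^ j) sums
        (\<epsilon> * (1 - z) powr (s - 1) + (\<Sum>j<N. d j * z ^ j))"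
      by (simp add: d_def algebra_simps)
    then have "(\<Sum>j<n. \<bar>p_coeff j s\<bar> * z ^ j) \<le> \<epsilon> * (1 - z) powr (s - 1) + (\<Sum>j<N. d j * z ^ j)"
      using z sum_le_suminf[of "\<lambda>j. \<bar>p_coeff j s\<bar> * z ^ j" "{..<n}"]
      by (auto simp: sums_iff)
    also have "\<epsilon> * (1 - z) powr (s - 1) \<le> (1 - z) powr (s - 1)"
      using \<epsilon> mult_right_mono[of \<epsilon> 1 "(1 - z) powr (s - 1)"] by auto
    also have "(\<Sum>j<N. d j * z ^ j) \<le> (\<Sum>j<N. d j)"
      using z d by (intro sum_mono mult_left_le power_le_one) auto
    finally show "(\<Sum>j<n. \<bar>p_coeff j s\<bar> * z ^ j) \<le> (\<Sum>j<N. d j) + (1 - z) powr (s - 1)"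
      by simp
  qed
qed

section \<open>Termwise integration of the binomial series\<close>

text \<open>Dominated convergence with the majorant |h| C + |h (1 - z)^(s - 1)|, whose two terms
  account for the two integrability hypotheses. The range of z is constrained only where h is
  nonzero, so that h can carry the indicator of a region.\<close>

lemma p_coeff_integral_sums:
  fixes h z :: "'a \<Rightarrow> real"
  assumes z[measurable]: "z \<in> borel_measurable M"
    and h[measurable]: "integrable M h"
    and hz: "integrable M (\<lambda>x. h x * (1 - z x) powr (s - 1))"
    and range: "\<And>x. x \<in> space M \<Longrightarrow> h x \<noteq> 0 \<Longrightarrow> 0 \<le> z x \<and> z x < 1"
  shows "(\<lambda>j. p_coeff j s * (\<integral>x. h x * z x ^ j \<partial>M)) sums (\<integral>x. h x * (1 - z x) powr (s - 1) \<partial>M)"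
proof -
  obtain C where C: "\<And>z n. 0 \<le> z \<Longrightarrow> z < 1 \<Longrightarrow>
      (\<Sum>j<n. \<bar>p_coeff j s\<bar> * z ^ j) \<le> C + (1 - z) powr (s - 1)"
    using p_coeff_abs_partial_sum_le[of s] by blast
  have int: "integrable M (\<lambda>x. h x * z x ^ j)" for j
  proof (rule Bochner_Integration.integrable_bound[OF h])
    have "\<bar>h x\<bar> * \<bar>z x\<bar> ^ j \<le> \<bar>h x\<bar>" if "x \<in> space M" for x
      using range[OF that] by (cases "h x = 0") (auto intro!: mult_left_le power_le_one)
    then show "AE x in M. norm (h x * z x ^ j) \<le> norm (h x)"
      by (auto simp: abs_mult power_abs)
  qed measurable
  let ?S = "\<lambda>n x. h x * (\<Sum>j<n. p_coeff j s * z x ^ j)"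
  have "(\<lambda>n. integral\<^sup>L M (?S n)) \<longlonglongrightarrow> (\<integral>x. h x * (1 - z x) powr (s - 1) \<partial>M)"
  proof (rule integral_dominated_convergence)
    show "integrable M (\<lambda>x. \<bar>h x\<bar> * C + \<bar>h x * (1 - z x) powr (s - 1)\<bar>)"
      using h hz by auto
    show "AE x in M. (\<lambda>n. ?S n x) \<longlonglongrightarrow> h x * (1 - z x) powr (s - 1)"
    proof (intro AE_I2)
      fix x assume x: "x \<in> space M"
      show "(\<lambda>n. ?S n x) \<longlonglongrightarrow> h x * (1 - z x) powr (s - 1)"
        using range[OF x] p_coeff_sums[of "z x" s]
        by (cases "h x = 0") (auto simp: sums_def intro!: tendsto_mult_left)
    qed
    fix n
    show "AE x in M. norm (?S n x) \<le> \<bar>h x\<bar> * C + \<bar>h x * (1 - z x) powr (s - 1)\<bar>"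
    proof (intro AE_I2)
      fix x assume x: "x \<in> space M"
      show "norm (?S n x) \<le> \<bar>h x\<bar> * C + \<bar>h x * (1 - z x) powr (s - 1)\<bar>"
      proof (cases "h x = 0")
        case False
        then have r: "0 \<le> z x" "z x < 1"
          using range[OF x] by auto
        have "\<bar>\<Sum>j<n. p_coeff j s * z x ^ j\<bar> \<le> (\<Sum>j<n. \<bar>p_coeff j s\<bar> * z x ^ j)"
          using r by (intro order_trans[OF sum_abs]) (simp add: abs_mult)
        also have "\<dots> \<le> C + (1 - z x) powr (s - 1)"
          using C r by blast
        finally show ?thesis
          by (simp add: abs_mult mult_left_mono distrib_left[symmetric])
      qed simp
    qed
  qed (use hz in measurable)
  moreover have "integral\<^sup>L M (?S n) = (\<Sum>j<n. p_coeff j s * (\<integral>x. h x * z x ^ j \<partial>M))" for n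
  proof -
    have "integral\<^sup>L M (?S n) = (\<integral>x. (\<Sum>j<n. p_coeff j s * (h x * z x ^ j)) \<partial>M)"
      by (simp add: sum_distrib_left mult_ac)
    then show ?thesis
      using int by (simp add: Bochner_Integration.integral_sum)
  qed
  ultimately show ?thesis
    by (simp add: sums_def)
qed

section \<open>Transport of the distribution to the unit interval\<close>

text \<open>A finite nonnegative integral is a real number \<open>r\<close>, so the substitution
  rule for absolutely integrable functions applies, and nonnegativity of \<open>k\<close> leads back
  to the nonnegative integral. In the application the finiteness is that of the measure of an
  event.\<close>

lemma nn_integral_change_of_variables_1:
  fixes g g' k :: "real \<Rightarrow> real"
  assumes S[measurable]: "S \<in> sets borel"
    and k[measurable]: "k \<in> borel_measurable borel" and g[measurable]: "g \<in> borel_measurable borel"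
    and g'[measurable]: "g' \<in> borel_measurable borel"
    and k_nonneg: "\<And>x. 0 \<le> k x"
    and der: "\<And>x. x \<in> S \<Longrightarrow> (g has_field_derivative g' x) (at x)"
    and inj: "inj_on g S"
    and fin: "(\<integral>\<^sup>+x. ennreal (\<bar>g' x\<bar> * k (g x)) * indicator S x \<partial>lborel) \<noteq> \<infinity>"
  shows "(\<integral>\<^sup>+x. ennreal (\<bar>g' x\<bar> * k (g x)) * indicator S x \<partial>lborel)
    = (\<integral>\<^sup>+u. ennreal (k u) * indicator (g ` S) u \<partial>lborel)"
proof -
  obtain r where r: "0 \<le> r"
    "(\<integral>\<^sup>+x. ennreal (\<bar>g' x\<bar> * k (g x)) * indicator S x \<partial>lborel) = ennreal r"
    using fin by (cases "(\<integral>\<^sup>+x. ennreal (\<bar>g' x\<bar> * k (g x)) * indicator S x \<partial>lborel)") auto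
  have "((\<lambda>x. \<bar>g' x\<bar> * k (g x) * indicator S x) has_integral r) UNIV"
    using r k_nonneg by (intro nn_integral_has_integral) (auto simp: ennreal_mult'' ennreal_indicator)
  moreover have "(\<lambda>x. \<bar>g' x\<bar> * k (g x) * indicator S x) = (\<lambda>x. if x \<in> S then \<bar>g' x\<bar> * k (g x) else 0)"
    by auto
  ultimately have *: "((\<lambda>x. \<bar>g' x\<bar> * k (g x)) has_integral r) S"
    by (simp only: has_integral_restrict_UNIV)
  then have "(\<lambda>x. \<bar>g' x\<bar> * k (g x)) absolutely_integrable_on S"
    using k_nonneg by (intro nonnegative_absolutely_integrable_1) auto
  with * have "k absolutely_integrable_on (g ` S) \<and> integral (g ` S) k = r"
    using has_absolute_integral_change_of_variables_1'[of S g g' k r] der inj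
    by (auto intro: DERIV_subset simp: integral_unique)
  then have "(k has_integral r) (g ` S)"
    using absolutely_integrable_on_def by blast
  then show ?thesis
    using r k_nonneg nn_integral_has_integral_lebesgue'[of "g ` S" k r] by simp
qed


text \<open>Up to the factor \<open>c / Beta a b\<close>, the density of a variable u on (0, 1) for
  which (1 - u)^c has the Beta law with parameters a and b. The constant is left out so that it can
  be pulled in front of the series.\<close>

definition unit_kernel :: "real \<Rightarrow> real \<Rightarrow> real \<Rightarrow> real \<Rightarrow> real" where
  "unit_kernel a b c u =
     indicator {0<..<1} u * ((1 - u) powr (a * c - 1) * (1 - (1 - u) powr c) powr (b - 1))"

lemma borel_measurable_unit_kernel [measurable]: "unit_kernel a b c \<in> borel_measurable borel"
  unfolding unit_kernel_def[abs_def] by measurable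

lemma unit_kernel_nonneg: "0 \<le> unit_kernel a b c u"
  by (simp add: unit_kernel_def)

lemma unit_kernel_mult_indicator: "unit_kernel a b c u * indicator {0<..<1} u = unit_kernel a b c u"
  by (simp add: unit_kernel_def indicator_def)

lemma Beta_pos:
  fixes a b :: real
  assumes "a > 0" "b > 0"
  shows "Beta a b > 0"
  using assms by (simp add: Beta_def Gamma_real_pos)

lemma image_exp_neg_powr:
  fixes \<gamma> \<theta> :: real
  assumes "\<gamma> > 0" "\<theta> > 0"
  shows "(\<lambda>x. exp (- \<gamma> * x powr (- \<theta>))) ` {0<..} = {0<..<1}"
proof (intro set_eqI iffI)
  fix u :: real assume u: "u \<in> {0<..<1}"
  \<comment> \<open>Solving u = exp (- \<gamma> x^(-\<theta>)) gives x^(-\<theta>) =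
    \<open>L\<close>, hence x = L^(-1/\<theta>).\<close>
  define L where "L = - ln u / \<gamma>"
  let ?x = "L powr (- 1 / \<theta>)"
  have "0 < L"
    using u assms by (simp add: L_def divide_neg_pos)
  then have "?x > 0" "?x powr (- \<theta>) = L"
    using assms by (simp_all add: powr_powr)
  moreover from this have "u = exp (- \<gamma> * ?x powr (- \<theta>))"
    using u assms by (simp add: L_def)
  ultimately show "u \<in> (\<lambda>x. exp (- \<gamma> * x powr (- \<theta>))) ` {0<..}"
    by blast
qed (use assms in auto)

text \<open>Both x^(-\<theta>) and exp (- \<gamma> t) are decreasing, and the two reversals cancel.
  This serves for the injectivity of the substitution and for rewriting the event Y < X.\<close>

lemma exp_neg_powr_less_iff:
  fixes \<gamma> \<theta> x y :: real
  assumes "\<gamma> > 0" "\<theta> > 0" "x > 0" "y > 0"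
  shows "exp (- \<gamma> * x powr (- \<theta>)) < exp (- \<gamma> * y powr (- \<theta>)) \<longleftrightarrow> x < y"
proof -
  have "y powr (- \<theta>) < x powr (- \<theta>) \<longleftrightarrow> x < y"
    using assms powr_less_mono2_neg[of "- \<theta>" x y] powr_less_mono2_neg[of "- \<theta>" y x]
    by (cases x y rule: linorder_cases) auto
  moreover have "exp (- \<gamma> * x powr (- \<theta>)) < exp (- \<gamma> * y powr (- \<theta>)) \<longleftrightarrow>
      \<gamma> * y powr (- \<theta>) < \<gamma> * x powr (- \<theta>)"
    by simp
  ultimately show ?thesis
    using assms by (simp only: mult_less_cancel_left_pos)
qed

text \<open>The density of X has the form |g'| (k o g) on the positive half-line, where g maps it
  bijectively onto (0, 1); so the substitution u = g x turns it into k.\<close>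

lemma distributed_exp_neg_powr:
  assumes pos: "\<gamma> > 0" "\<theta> > 0" "a > 0" "b > 0" "c > 0"
    and M: "finite_measure M"
    and X: "has_rGB1_IWei_distribution M X \<gamma> \<theta> a b c"
  shows "distributed M lborel (\<lambda>\<omega>. exp (- \<gamma> * X \<omega> powr (- \<theta>)))
    (\<lambda>u. ennreal (c / Beta a b * unit_kernel a b c u))"
proof -
  interpret finite_measure M by fact
  define g where "g x = exp (- \<gamma> * x powr (- \<theta>))" for x :: real
  define g' where "g' x = \<gamma> * \<theta> * x powr (- \<theta> - 1) * g x" for x :: real
  define k where "k u = c / Beta a b * unit_kernel a b c u" for u
  have [measurable]: "g \<in> borel_measurable borel" "g' \<in> borel_measurable borel"
      "k \<in> borel_measurable borel"
    unfolding g_def[abs_def] g'_def[abs_def] k_def[abs_def] by measurable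
  note D = X[unfolded has_rGB1_IWei_distribution_def]
  have [measurable]: "X \<in> borel_measurable M"
    using distributed_measurable[OF D] by simp
  have img: "g ` {0<..} = {0<..<1}"
    using image_exp_neg_powr[OF pos(1,2)] by (simp add: g_def[abs_def])
  have inj: "inj_on g {0<..}"
  proof (rule linorder_inj_onI')
    fix x y :: real assume "x \<in> {0<..}" "y \<in> {0<..}" "x < y"
    then have "g x < g y"
      using exp_neg_powr_less_iff[OF pos(1,2), of x y] unfolding g_def by simp
    then show "g x \<noteq> g y" by simp
  qed
  have der: "(g has_field_derivative g' x) (at x)" if "x \<in> {0<..}" for x
    unfolding g_def[abs_def] g'_def
    by (rule derivative_eq_intros refl | use that in simp)+
  have k_nonneg: "0 \<le> k u" for u
    using pos Beta_pos[of a b] by (simp add: k_def unit_kernel_nonneg)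
  have dens: "rGB1_IWei_density \<gamma> \<theta> a b c x = \<bar>g' x\<bar> * k (g x) * indicator {0<..} x" for x
  proof (cases "x > 0")
    case True
    then have "g x \<in> {0<..<1}"
      using img by blast
    with True pos show ?thesis
      by (simp add: rGB1_IWei_density_def g'_def k_def unit_kernel_def abs_mult)
         (simp add: g_def)
  qed (simp add: rGB1_IWei_density_def)
  have "distr M lborel (\<lambda>\<omega>. g (X \<omega>)) = density lborel k"
  proof (rule measure_eqI)
    fix A assume "A \<in> sets (distr M lborel (\<lambda>\<omega>. g (X \<omega>)))"
    then have [measurable]: "A \<in> sets borel" by simp
    have gA: "g -` A \<in> sets lborel"
      using measurable_sets_borel[of g borel A] by simp
    \<comment> \<open>With the indicator of \<open>A\<close> moved into the integrand, the
      substitution is made on the whole half-line rather than on the preimage of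
      \<open>A\<close>.\<close>
    let ?k = "\<lambda>u. k u * indicator A u"
    have "emeasure (distr M lborel (\<lambda>\<omega>. g (X \<omega>))) A = emeasure M (X -` (g -` A) \<inter> space M)"
      by (subst emeasure_distr) (auto intro!: arg_cong[where f = "emeasure M"])
    also have eq: "\<dots> = (\<integral>\<^sup>+x. ennreal (\<bar>g' x\<bar> * ?k (g x)) * indicator {0<..} x \<partial>lborel)"
      unfolding distributed_emeasure[OF D gA] dens
      by (intro nn_integral_cong) (auto split: split_indicator)
    also have "\<dots> = (\<integral>\<^sup>+u. ennreal (?k u) * indicator (g ` {0<..}) u \<partial>lborel)"
    proof (rule nn_integral_change_of_variables_1)
      show "(\<integral>\<^sup>+x. ennreal (\<bar>g' x\<bar> * ?k (g x)) * indicator {0<..} x \<partial>lborel) \<noteq> \<infinity>"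
        using emeasure_finite eq[symmetric] by simp
    qed (use k_nonneg der inj in auto)
    also have "\<dots> = emeasure (density lborel k) A"
      unfolding img
      by (subst emeasure_density) (auto intro!: nn_integral_cong simp: k_def unit_kernel_def split: split_indicator)
    finally show "emeasure (distr M lborel (\<lambda>\<omega>. g (X \<omega>))) A = emeasure (density lborel k) A" .
  qed simp
  then show ?thesis
    unfolding distributed_def k_def[symmetric] g_def[symmetric] by simp
qed

text \<open>A density determines X only up to null sets, so positivity holds almost surely; the
  comparison of Y and X through the exponentials relies on it.\<close>

lemma AE_rGB1_IWei_pos:
  assumes X: "has_rGB1_IWei_distribution M X \<gamma> \<theta> a b c"
  shows "AE \<omega> in M. X \<omega> > 0"
proof -
  note D = X[unfolded has_rGB1_IWei_distribution_def]
  have "AE x in distr M lborel X. x > 0"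
    unfolding distributed_distr_eq_density[OF D]
    by (subst AE_density[OF distributed_borel_measurable[OF D]]) (auto simp: rGB1_IWei_density_def)
  then show ?thesis
    using distributed_measurable[OF D] by (subst (asm) AE_distr_iff) auto
qed

section \<open>The double expansion of the kernel\<close>

text \<open>With z = (1 - v)^c the kernel is (1 - v)^(ac - 1) (1 - z)^(b - 1). Expanding the last
  factor in powers of z leaves (1 - v)^(c(a + j) - 1), which is then expanded in powers of v with s
  = c(a + j). The factor h holds whatever depends on the other variable.\<close>

lemma unit_kernel_sums:
  fixes h v :: "'a \<Rightarrow> real"
  assumes v[measurable]: "v \<in> borel_measurable M"
    and h[measurable]: "integrable M h"
    and h1: "integrable M (\<lambda>x. h x * (1 - v x) powr (a * c - 1))"
    and hK: "integrable M (\<lambda>x. h x * unit_kernel a b c (v x))"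
    and range: "\<And>x. x \<in> space M \<Longrightarrow> h x \<noteq> 0 \<Longrightarrow> 0 < v x \<and> v x < 1"
    and c: "c > 0"
  shows "\<And>j. (\<lambda>i. p_coeff i (c * (a + real j)) * (\<integral>x. h x * v x ^ i \<partial>M)) sums
      (\<integral>x. h x * (1 - v x) powr (c * (a + real j) - 1) \<partial>M)"
    and "(\<lambda>j. p_coeff j b * (\<integral>x. h x * (1 - v x) powr (c * (a + real j) - 1) \<partial>M)) sums
      (\<integral>x. h x * unit_kernel a b c (v x) \<partial>M)"
proof -
  define z where "z x = (1 - v x) powr c" for x
  have z[measurable]: "z \<in> borel_measurable M"
    unfolding z_def[abs_def] by measurable
  have z1: "0 < z x \<and> z x < 1" if "x \<in> space M" "h x \<noteq> 0" for x
    using range[OF that] c powr_less_mono2[of c "1 - v x" 1] by (simp add: z_def)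
  have split: "h x * (1 - v x) powr (c * (a + real j) - 1) = h x * (1 - v x) powr (a * c - 1) * z x ^ j"
    if "x \<in> space M" for x j
    using range[OF that]
    by (cases "h x = 0") (auto simp: z_def powr_realpow[symmetric] powr_powr powr_add[symmetric] algebra_simps)
  have kernel: "h x * unit_kernel a b c (v x) = h x * (1 - v x) powr (a * c - 1) * (1 - z x) powr (b - 1)"
    if "x \<in> space M" for x
    using range[OF that] by (cases "h x = 0") (auto simp: z_def unit_kernel_def)
  show "(\<lambda>i. p_coeff i (c * (a + real j)) * (\<integral>x. h x * v x ^ i \<partial>M)) sums
      (\<integral>x. h x * (1 - v x) powr (c * (a + real j) - 1) \<partial>M)" for j
  proof (rule p_coeff_integral_sums)
    \<comment> \<open>Since 0 < z < 1 where h is nonzero, the factor z^j does not increase the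
      modulus, and the case j = 0 given by \<open>h1\<close> dominates.\<close>
    show "integrable M (\<lambda>x. h x * (1 - v x) powr (c * (a + real j) - 1))"
    proof (rule Bochner_Integration.integrable_bound[OF h1])
      have "\<bar>h x * (1 - v x) powr (a * c - 1) * z x ^ j\<bar> \<le> \<bar>h x * (1 - v x) powr (a * c - 1)\<bar>"
        if "x \<in> space M" for x
        using z1[OF that] by (cases "h x = 0") (auto simp: abs_mult power_abs intro!: mult_left_le power_le_one)
      then show "AE x in M. norm (h x * (1 - v x) powr (c * (a + real j) - 1)) \<le> norm (h x * (1 - v x) powr (a * c - 1))"
        by (auto simp: split)
    qed measurable
  qed (use range h in \<open>auto intro: less_imp_le\<close>)
  have "(\<lambda>j. p_coeff j b * (\<integral>x. h x * (1 - v x) powr (a * c - 1) * z x ^ j \<partial>M)) sums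
      (\<integral>x. h x * (1 - v x) powr (a * c - 1) * (1 - z x) powr (b - 1) \<partial>M)"
  proof (rule p_coeff_integral_sums)
    show "integrable M (\<lambda>x. h x * (1 - v x) powr (a * c - 1) * (1 - z x) powr (b - 1))"
      using hK by (simp add: kernel cong: Bochner_Integration.integrable_cong)
  qed (use z1 h1 in \<open>auto intro: less_imp_le\<close>)
  then show "(\<lambda>j. p_coeff j b * (\<integral>x. h x * (1 - v x) powr (c * (a + real j) - 1) \<partial>M)) sums
      (\<integral>x. h x * unit_kernel a b c (v x) \<partial>M)"
    by (simp add: split kernel cong: Bochner_Integration.integral_cong)
qed

section \<open>Integrals over the region v < u^\<rho>\<close>

lemma has_bochner_integral_powr_Ioo:
  fixes a c :: real
  assumes "a > -1" "c \<ge> 0"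
  shows "has_bochner_integral lborel (\<lambda>x. x powr a * indicator {0<..<c} x) (c powr (a + 1) / (a + 1))"
proof (rule has_bochner_integral_nn_integral)
  have "((\<lambda>x. x powr a) has_integral (c powr (a + 1) / (a + 1))) {0<..<c}"
    using has_integral_powr_from_0[OF assms] by (simp add: has_integral_Icc_iff_Ioo)
  then have "(\<integral>\<^sup>+x. ennreal (x powr a) * indicator {0<..<c} x \<partial>lborel) = ennreal (c powr (a + 1) / (a + 1))"
    by (intro nn_integral_has_integral_lebesgue') auto
  then show "(\<integral>\<^sup>+x. ennreal (x powr a * indicator {0<..<c} x) \<partial>lborel) = ennreal (c powr (a + 1) / (a + 1))"
    by (simp add: ennreal_mult'' ennreal_indicator)
qed (use assms in auto)

lemma integrable_one_minus_powr:
  fixes p :: real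
  assumes "p > 0"
  shows "integrable lborel (\<lambda>x. (1 - x) powr (p - 1) * indicator {0<..<1} x)"
proof -
  have "integrable lborel (\<lambda>x. x powr (p - 1) * indicator {0<..<1} x)"
    using has_bochner_integral_powr_Ioo[of "p - 1" 1] assms by (simp add: has_bochner_integral_iff)
  then have "integrable lborel (\<lambda>x. (1 + (-1) * x) powr (p - 1) * indicator {0<..<1} (1 + (-1) * x))"
    by (rule lborel_integrable_real_affine) simp
  then show ?thesis
    by (rule back_subst[of "integrable lborel"]) (auto split: split_indicator)
qed

text \<open>The first coordinate stands for U, the second for V. For \<rho> > 0 the region lies in
  the open unit square, as u^\<rho> < 1.\<close>

definition power_region :: "real \<Rightarrow> (real \<times> real) set" where
  "power_region \<rho> = {p. 0 < fst p \<and> fst p < 1 \<and> 0 < snd p \<and> snd p < fst p powr \<rho>}"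

lemma sets_power_region [measurable]: "power_region \<rho> \<in> sets (borel \<Otimes>\<^sub>M borel)"
proof -
  have "{p \<in> space (borel \<Otimes>\<^sub>M borel). 0 < fst p \<and> fst p < 1 \<and> 0 < snd p \<and> snd p < fst p powr \<rho>}
      \<in> sets (borel \<Otimes>\<^sub>M borel :: (real \<times> real) measure)"
    by measurable
  then show ?thesis
    by (simp add: power_region_def space_pair_measure)
qed

text \<open>Integrating v^j up to u^\<rho> gives u^(\<rho>(j + 1)) / (j + 1), and then a power of u
  is integrated over (0, 1). The factors are ordered as h z^i with h = v^j times the indicator, the
  shape needed for termwise integration.\<close>

lemma integral_power_region:
  fixes \<rho> :: real
  assumes "\<rho> > 0"
  shows "(\<integral>p. snd p ^ j * indicator (power_region \<rho>) p * fst p ^ i \<partial>(lborel \<Otimes>\<^sub>M lborel))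
    = 1 / ((real j + 1) * (real i + 1 + \<rho> * (real j + 1)))"
proof -
  let ?f = "\<lambda>p. snd p ^ j * indicator (power_region \<rho>) p * fst p ^ i"
  have inner: "has_bochner_integral lborel (\<lambda>w. ?f (u, w))
      (u powr (real i + \<rho> * (real j + 1)) * indicator {0<..<1} u / (real j + 1))" for u
  proof (cases "u \<in> {0<..<1}")
    case True
    have "has_bochner_integral lborel (\<lambda>w. w powr real j * indicator {0<..<u powr \<rho>} w * u ^ i)
        ((u powr \<rho>) powr (real j + 1) / (real j + 1) * u ^ i)"
      by (intro has_bochner_integral_mult_left has_bochner_integral_powr_Ioo) auto
    also have "(\<lambda>w. w powr real j * indicator {0<..<u powr \<rho>} w * u ^ i) = (\<lambda>w. ?f (u, w))"
      using True by (auto simp: power_region_def fun_eq_iff powr_realpow split: split_indicator)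
    also have "(u powr \<rho>) powr (real j + 1) / (real j + 1) * u ^ i
        = u powr (real i + \<rho> * (real j + 1)) * indicator {0<..<1} u / (real j + 1)"
      using True by (simp add: powr_powr powr_add powr_realpow distrib_left)
    finally show ?thesis .
  next
    case False
    then have "(\<lambda>w. ?f (u, w)) = (\<lambda>w. 0)"
      by (auto simp: power_region_def fun_eq_iff)
    with False show ?thesis
      by (simp add: has_bochner_integral_zero)
  qed
  \<comment> \<open>The integrand is nonnegative, so the iterated integral just computed also proves
    integrability for Fubini.\<close>
  have norm_eq: "norm (?f p) = ?f p" for p
    by (auto simp: power_region_def indicator_def)
  have r: "real i + \<rho> * (real j + 1) > -1"
    using assms by (smt (verit) mult_nonneg_nonneg of_nat_0_le_iff)
  have outer: "has_bochner_integral lborel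
      (\<lambda>u. u powr (real i + \<rho> * (real j + 1)) * indicator {0<..<1} u / (real j + 1))
      (1 / ((real j + 1) * (real i + 1 + \<rho> * (real j + 1))))"
    using has_bochner_integral_divide_zero[OF has_bochner_integral_powr_Ioo[OF r, of 1], of "real j + 1"]
    by (simp add: algebra_simps)
  have inner_eq: "(\<integral>w. ?f (u, w) \<partial>lborel) =
      u powr (real i + \<rho> * (real j + 1)) * indicator {0<..<1} u / (real j + 1)" for u
    using inner has_bochner_integral_integral_eq by blast
  have "integrable (lborel \<Otimes>\<^sub>M lborel) ?f"
  proof (rule lborel_pair.Fubini_integrable)
    show "integrable lborel (\<lambda>u. \<integral>w. norm (?f (u, w)) \<partial>lborel)"
      using outer unfolding norm_eq inner_eq by (rule integrable.intros)
    show "AE u in lborel. integrable lborel (\<lambda>w. ?f (u, w))"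
      using inner by (auto simp: has_bochner_integral_iff)
  qed measurable
  then have "(\<integral>p. ?f p \<partial>(lborel \<Otimes>\<^sub>M lborel)) = (\<integral>u. (\<integral>w. ?f (u, w) \<partial>lborel) \<partial>lborel)"
    by (rule lborel_pair.integral_fst'[symmetric])
  also have "\<dots> = 1 / ((real j + 1) * (real i + 1 + \<rho> * (real j + 1)))"
    unfolding inner_eq using outer by (rule has_bochner_integral_integral_eq)
  finally show ?thesis .
qed

lemma integrable_lborel_pair_mult:
  fixes G H :: "real \<Rightarrow> real"
  assumes G[measurable]: "integrable lborel G" and H[measurable]: "integrable lborel H"
  shows "integrable (lborel \<Otimes>\<^sub>M lborel) (\<lambda>p. G (fst p) * H (snd p))"
proof (rule lborel_pair.Fubini_integrable)
  show "integrable lborel (\<lambda>u. \<integral>w. norm (G (fst (u, w)) * H (snd (u, w))) \<partial>lborel)"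
    using G by (simp add: abs_mult)
qed (use H in auto)


text \<open>The region lies in the unit square, so a product of two functions integrable on (0, 1)
  dominates.\<close>

lemma integrable_power_region:
  fixes G H :: "real \<Rightarrow> real"
  assumes "\<rho> > 0"
    and [measurable]: "G \<in> borel_measurable borel" "H \<in> borel_measurable borel"
    and G: "integrable lborel (\<lambda>u. G u * indicator {0<..<1} u)"
    and H: "integrable lborel (\<lambda>u. H u * indicator {0<..<1} u)"
  shows "integrable (lborel \<Otimes>\<^sub>M lborel) (\<lambda>p. G (fst p) * H (snd p) * indicator (power_region \<rho>) p)"
proof (rule Bochner_Integration.integrable_bound[OF integrable_lborel_pair_mult[OF G H]])
  have "snd p < 1" if "p \<in> power_region \<rho>" for p
    using that assms(1) powr_less_mono2[of \<rho> "fst p" 1] by (simp add: power_region_def)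
  then show "AE p in lborel \<Otimes>\<^sub>M lborel. norm (G (fst p) * H (snd p) * indicator (power_region \<rho>) p)
      \<le> norm (G (fst p) * indicator {0<..<1} (fst p) * (H (snd p) * indicator {0<..<1} (snd p)))"
    by (intro AE_I2) (auto split: split_indicator simp: power_region_def)
qed measurable

section \<open>Evaluation of the fourfold series\<close>

text \<open>The sums are evaluated from the inside out, so their order is never exchanged: j4 and j3
  rebuild the kernel in u while v^j2 is kept fixed, then j2 and j1 rebuild the kernel in v.\<close>

lemma iterated_series:
  fixes a b c a' b' c' \<rho> :: real
  defines "t \<equiv> \<lambda>j1 j2 j3 j4 :: nat. p_coeff j1 b' * p_coeff j2 (c' * (a' + real j1))
      * p_coeff j3 b * p_coeff j4 (c * (a + real j3))
      * (1 / ((real j2 + 1) * (real j4 + 1 + \<rho> * (real j2 + 1))))"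
  assumes pos: "\<rho> > 0" "a > 0" "c > 0" "a' > 0" "c' > 0"
    and K: "integrable lborel (unit_kernel a b c)" "integrable lborel (unit_kernel a' b' c')"
  shows "summable (\<lambda>j4. t j1 j2 j3 j4)"
    and "summable (\<lambda>j3. \<Sum>j4. t j1 j2 j3 j4)"
    and "summable (\<lambda>j2. \<Sum>j3. \<Sum>j4. t j1 j2 j3 j4)"
    and "summable (\<lambda>j1. \<Sum>j2. \<Sum>j3. \<Sum>j4. t j1 j2 j3 j4)"
    and "(\<Sum>j1. \<Sum>j2. \<Sum>j3. \<Sum>j4. t j1 j2 j3 j4) =
      (\<integral>p. unit_kernel a b c (fst p) * unit_kernel a' b' c' (snd p) * indicator (power_region \<rho>) p
        \<partial>(lborel \<Otimes>\<^sub>M lborel))"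
proof -
  let ?L = "lborel \<Otimes>\<^sub>M lborel :: (real \<times> real) measure"
  let ?I = "\<lambda>p. indicator (power_region \<rho>) p :: real"
  have region: "0 < fst p \<and> fst p < 1 \<and> 0 < snd p \<and> snd p < 1" if "p \<in> power_region \<rho>" for p
    using that pos(1) powr_less_mono2[of \<rho> "fst p" 1] by (simp add: power_region_def)
  have int_K: "integrable lborel (\<lambda>u. unit_kernel a b c u * indicator {0<..<1} u)"
      "integrable lborel (\<lambda>u. unit_kernel a' b' c' u * indicator {0<..<1} u)"
    using K by (simp_all add: unit_kernel_mult_indicator)
  have int_pow: "integrable lborel (\<lambda>u::real. u ^ j * indicator {0<..<1} u)" for j
  proof (rule Bochner_Integration.integrable_bound)
    show "AE u in lborel. norm (u ^ j * indicator {0<..<1} u :: real) \<le> norm (indicator {0<..<1} u :: real)"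
      by (intro AE_I2) (auto split: split_indicator simp: power_abs intro: power_le_one)
  qed (auto simp: integrable_indicator_iff)
  have int_beta: "integrable lborel (\<lambda>u. (1 - u) powr (a * c - 1) * indicator {0<..<1} u)"
      "integrable lborel (\<lambda>u. (1 - u) powr (a' * c' - 1) * indicator {0<..<1} u)"
    using pos by (auto intro!: integrable_one_minus_powr)
  note region_int = integrable_power_region[OF pos(1)]
  let ?h = "\<lambda>j p. snd p ^ j * ?I p"
  have h: "integrable ?L (?h j)" "integrable ?L (\<lambda>p. ?h j p * (1 - fst p) powr (a * c - 1))"
      "integrable ?L (\<lambda>p. ?h j p * unit_kernel a b c (fst p))" for j
    \<comment> \<open>The exponent 0 supplies the constant factor 1 on (0, 1).\<close>
    using region_int[OF _ _ int_pow[of 0] int_pow[of j]] region_int[OF _ _ int_beta(1) int_pow[of j]]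
      region_int[OF _ _ int_K(1) int_pow[of j]]
    by (simp_all add: mult_ac)
  let ?k = "\<lambda>p. unit_kernel a b c (fst p) * ?I p"
  have k: "integrable ?L ?k" "integrable ?L (\<lambda>p. ?k p * (1 - snd p) powr (a' * c' - 1))"
      "integrable ?L (\<lambda>p. ?k p * unit_kernel a' b' c' (snd p))"
    using region_int[OF _ _ int_K(1) int_pow[of 0]] region_int[OF _ _ int_K(1) int_beta(2)]
      region_int[OF _ _ int_K(1) int_K(2)]
    by (simp_all add: mult_ac)
  have sums_h: "(\<lambda>j4. p_coeff j4 (c * (a + real j3)) * (\<integral>p. ?h j2 p * fst p ^ j4 \<partial>?L)) sums
        (\<integral>p. ?h j2 p * (1 - fst p) powr (c * (a + real j3) - 1) \<partial>?L)"
      "(\<lambda>j3. p_coeff j3 b * (\<integral>p. ?h j2 p * (1 - fst p) powr (c * (a + real j3) - 1) \<partial>?L)) sums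
        (\<integral>p. ?h j2 p * unit_kernel a b c (fst p) \<partial>?L)" for j2 j3
    by (rule unit_kernel_sums[OF _ h(1) h(2) h(3)]; use region pos in \<open>auto simp: indicator_def\<close>)+
  have sums_k: "(\<lambda>j2. p_coeff j2 (c' * (a' + real j1)) * (\<integral>p. ?k p * snd p ^ j2 \<partial>?L)) sums
        (\<integral>p. ?k p * (1 - snd p) powr (c' * (a' + real j1) - 1) \<partial>?L)"
      "(\<lambda>j1. p_coeff j1 b' * (\<integral>p. ?k p * (1 - snd p) powr (c' * (a' + real j1) - 1) \<partial>?L)) sums
        (\<integral>p. ?k p * unit_kernel a' b' c' (snd p) \<partial>?L)" for j1
    by (rule unit_kernel_sums[OF _ k]; use region pos in \<open>auto simp: indicator_def\<close>)+
  have t: "t j1 j2 j3 j4 = p_coeff j1 b' * p_coeff j2 (c' * (a' + real j1)) * p_coeff j3 b *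
      (p_coeff j4 (c * (a + real j3)) * (\<integral>p. ?h j2 p * fst p ^ j4 \<partial>?L))" for j1 j2 j3 j4
    unfolding t_def integral_power_region[OF pos(1)] by (simp only: mult.assoc)
  \<comment> \<open>In \<open>S4\<close> to \<open>S1\<close>, each value obtained by
    \<open>sums_unique\<close> replaces the inner sum in the next summand, so convergence of every
    level is established along the way.\<close>
  have S4: "t j1 j2 j3 sums (p_coeff j1 b' * p_coeff j2 (c' * (a' + real j1)) *
      (p_coeff j3 b * (\<integral>p. ?h j2 p * (1 - fst p) powr (c * (a + real j3) - 1) \<partial>?L)))" for j1 j2 j3
    using sums_mult[OF sums_h(1)[of j3 j2], of "p_coeff j1 b' * p_coeff j2 (c' * (a' + real j1)) * p_coeff j3 b"]
    by (simp only: t[abs_def] mult.assoc)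
  note E4 = sums_unique[OF S4, symmetric]
  have S3: "(\<lambda>j3. \<Sum>j4. t j1 j2 j3 j4) sums (p_coeff j1 b' *
      (p_coeff j2 (c' * (a' + real j1)) * (\<integral>p. ?k p * snd p ^ j2 \<partial>?L)))" for j1 j2
    unfolding E4
    using sums_mult[OF sums_h(2)[of j2], of "p_coeff j1 b' * p_coeff j2 (c' * (a' + real j1))"]
    by (simp add: mult_ac)
  note E3 = sums_unique[OF S3, symmetric]
  have S2: "(\<lambda>j2. \<Sum>j3. \<Sum>j4. t j1 j2 j3 j4) sums (p_coeff j1 b' *
      (\<integral>p. ?k p * (1 - snd p) powr (c' * (a' + real j1) - 1) \<partial>?L))" for j1
    unfolding E3 by (intro sums_mult sums_k(1))
  note E2 = sums_unique[OF S2, symmetric]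
  have S1: "(\<lambda>j1. \<Sum>j2. \<Sum>j3. \<Sum>j4. t j1 j2 j3 j4) sums
      (\<integral>p. ?k p * unit_kernel a' b' c' (snd p) \<partial>?L)"
    unfolding E2 by (rule sums_k(2))
  show "summable (\<lambda>j4. t j1 j2 j3 j4)" "summable (\<lambda>j3. \<Sum>j4. t j1 j2 j3 j4)"
      "summable (\<lambda>j2. \<Sum>j3. \<Sum>j4. t j1 j2 j3 j4)" "summable (\<lambda>j1. \<Sum>j2. \<Sum>j3. \<Sum>j4. t j1 j2 j3 j4)"
    by (fact sums_summable[OF S4] sums_summable[OF S3] sums_summable[OF S2] sums_summable[OF S1])+
  show "(\<Sum>j1. \<Sum>j2. \<Sum>j3. \<Sum>j4. t j1 j2 j3 j4) =
      (\<integral>p. unit_kernel a b c (fst p) * unit_kernel a' b' c' (snd p) * ?I p \<partial>?L)"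
    using sums_unique[OF S1, symmetric] by (simp add: mult_ac)
qed

section \<open>The probability as an integral, and the conclusion\<close>

text \<open>Integrability is read off from the existence of a variable with this law: a constant is
  integrable over a finite measure, and transfer to the law of U multiplies it by the density. The
  behaviour of the kernel at 0 and 1 is not examined.\<close>

lemma integrable_unit_kernel:
  assumes pos: "\<gamma> > 0" "\<theta> > 0" "a > 0" "b > 0" "c > 0"
    and M: "finite_measure M"
    and X: "has_rGB1_IWei_distribution M X \<gamma> \<theta> a b c"
  shows "integrable lborel (unit_kernel a b c)"
proof -
  interpret finite_measure M by fact
  have C: "c / Beta a b > 0"
    using pos Beta_pos[of a b] by simp
  have "integrable lborel (\<lambda>u. c / Beta a b * unit_kernel a b c u * (Beta a b / c))"
    using C
    by (subst distributed_integrable[OF distributed_exp_neg_powr[OF assms]])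
       (auto intro!: mult_nonneg_nonneg simp: unit_kernel_nonneg simp del: times_divide_eq_left)
  moreover have "c / Beta a b * unit_kernel a b c u * (Beta a b / c) = unit_kernel a b c u" for u
    using pos Beta_pos[of a b] by simp
  ultimately show ?thesis
    by simp
qed

lemma prob_less_eq_integral:
  fixes X Y :: "'w \<Rightarrow> real" and \<gamma>x \<gamma>y \<theta> ax bx cx ay by' cy :: real
  assumes pos: "ax > 0" "bx > 0" "cx > 0" "\<gamma>x > 0" "ay > 0" "by' > 0" "cy > 0" "\<gamma>y > 0" "\<theta> > 0"
    and M: "prob_space M"
    and ind: "prob_space.indep_var M borel X borel Y"
    and X: "has_rGB1_IWei_distribution M X \<gamma>x \<theta> ax bx cx"
    and Y: "has_rGB1_IWei_distribution M Y \<gamma>y \<theta> ay by' cy"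
  shows "measure M {\<omega> \<in> space M. Y \<omega> < X \<omega>} = cx * cy / (Beta ax bx * Beta ay by') *
    (\<integral>p. unit_kernel ax bx cx (fst p) * unit_kernel ay by' cy (snd p) *
      indicator (power_region (\<gamma>y / \<gamma>x)) p \<partial>(lborel \<Otimes>\<^sub>M lborel))"
proof -
  interpret prob_space M by fact
  let ?L = "lborel \<Otimes>\<^sub>M lborel :: (real \<times> real) measure"
  define U where "U \<omega> = exp (- \<gamma>x * X \<omega> powr (- \<theta>))" for \<omega>
  define V where "V \<omega> = exp (- \<gamma>y * Y \<omega> powr (- \<theta>))" for \<omega>
  define ku where "ku u = cx / Beta ax bx * unit_kernel ax bx cx u" for u
  define kv where "kv v = cy / Beta ay by' * unit_kernel ay by' cy v" for v
  let ?D = "power_region (\<gamma>y / \<gamma>x)"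
  have DU: "distributed M lborel U ku"
    using distributed_exp_neg_powr[OF _ _ _ _ _ _ X] pos finite_measure_axioms
    by (simp add: U_def[abs_def] ku_def)
  have DV: "distributed M lborel V kv"
    using distributed_exp_neg_powr[OF _ _ _ _ _ _ Y] pos finite_measure_axioms
    by (simp add: V_def[abs_def] kv_def)
  have "indep_var lborel ((\<lambda>x. exp (- \<gamma>x * x powr (- \<theta>))) \<circ> X) lborel ((\<lambda>y. exp (- \<gamma>y * y powr (- \<theta>))) \<circ> Y)"
    by (rule indep_var_compose[OF ind]) measurable
  then have "indep_var lborel U lborel V"
    by (simp only: U_def[abs_def] V_def[abs_def] comp_def)
  then have D: "distributed M ?L (\<lambda>\<omega>. (U \<omega>, V \<omega>)) (\<lambda>(u, v). ennreal (ku u) * ennreal (kv v))"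
    by (intro distributed_joint_indep DU DV sigma_finite_lborel)
  have XY[measurable]: "X \<in> borel_measurable M" "Y \<in> borel_measurable M"
    using indep_var_rv1[OF ind] indep_var_rv2[OF ind] by auto
  have [measurable]: "U \<in> borel_measurable M" "V \<in> borel_measurable M"
    unfolding U_def[abs_def] V_def[abs_def] by measurable
  \<comment> \<open>Because \<theta> is common to both variables, U^(\<gamma>y/\<gamma>x) is the
    exponential of Y evaluated at X, and monotonicity compares the arguments.\<close>
  have region: "Y \<omega> < X \<omega> \<longleftrightarrow> (U \<omega>, V \<omega>) \<in> ?D" if "X \<omega> > 0" "Y \<omega> > 0" for \<omega>
  proof -
    have "U \<omega> powr (\<gamma>y / \<gamma>x) = exp (- \<gamma>y * X \<omega> powr (- \<theta>))"
      using pos by (simp add: U_def exp_powr_real)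
    then show ?thesis
      using exp_neg_powr_less_iff[of \<gamma>y \<theta> "Y \<omega>" "X \<omega>"] that pos
      by (auto simp: power_region_def V_def U_def)
  qed
  have "emeasure M {\<omega> \<in> space M. Y \<omega> < X \<omega>} = emeasure M ((\<lambda>\<omega>. (U \<omega>, V \<omega>)) -` ?D \<inter> space M)"
  proof (rule emeasure_eq_AE)
    show "AE \<omega> in M. \<omega> \<in> {\<omega> \<in> space M. Y \<omega> < X \<omega>} \<longleftrightarrow> \<omega> \<in> (\<lambda>\<omega>. (U \<omega>, V \<omega>)) -` ?D \<inter> space M"
      using AE_rGB1_IWei_pos[OF X] AE_rGB1_IWei_pos[OF Y] by eventually_elim (auto simp: region)
  qed measurable
  also have "\<dots> = (\<integral>\<^sup>+p. (case p of (u, v) \<Rightarrow> ennreal (ku u) * ennreal (kv v)) * indicator ?D p \<partial>?L)"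
    by (rule distributed_emeasure[OF D]) measurable
  also have "\<dots> = (\<integral>\<^sup>+p. ennreal (cx * cy / (Beta ax bx * Beta ay by') *
      (unit_kernel ax bx cx (fst p) * unit_kernel ay by' cy (snd p) * indicator ?D p)) \<partial>?L)"
    using pos Beta_pos[of ax bx] Beta_pos[of ay by']
    by (intro nn_integral_cong)
       (auto simp: ku_def kv_def unit_kernel_nonneg mult_ac split: split_indicator simp flip: ennreal_mult)
  finally have "measure M {\<omega> \<in> space M. Y \<omega> < X \<omega>} = (\<integral>p. cx * cy / (Beta ax bx * Beta ay by') *
      (unit_kernel ax bx cx (fst p) * unit_kernel ay by' cy (snd p) * indicator ?D p) \<partial>?L)"
    unfolding measure_def using pos Beta_pos[of ax bx] Beta_pos[of ay by']
    by (subst integral_eq_nn_integral) (auto simp: unit_kernel_nonneg)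
  then show ?thesis
    by simp
qed

text \<open>The summability clauses ensure that each \<open>suminf\<close> is a genuine limit, since
  \<open>suminf\<close> is a total function with a value for divergent series too.\<close>

theorem mainTheorem5:
  fixes M :: "'w measure"
    and X Y :: "'w \<Rightarrow> real"
    and ax bx cx \<gamma>x ay by' cy \<gamma>y \<theta> :: real
  assumes "ax > 0" "bx > 0" "cx > 0" "\<gamma>x > 0"
    and "ay > 0" "by' > 0" "cy > 0" "\<gamma>y > 0"
    and "\<theta> > 0"
    and "prob_space M"
    and "prob_space.indep_var M borel X borel Y"
    and "has_rGB1_IWei_distribution M X \<gamma>x \<theta> ax bx cx"
    and "has_rGB1_IWei_distribution M Y \<gamma>y \<theta> ay by' cy"
  shows "let t = (\<lambda>j1 j2 j3 j4 :: nat.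
             p_coeff j1 by' * p_coeff j2 (cy * (ay + real j1))
               * p_coeff j3 bx * p_coeff j4 (cx * (ax + real j3))
               * (\<gamma>x * (real j4 + 1))
             / ((real j2 + 1) * (real j4 + 1)
                 * (\<gamma>x * (real j4 + 1) + \<gamma>y * (real j2 + 1))))
         in (\<forall>j1 j2 j3. summable (\<lambda>j4. t j1 j2 j3 j4))
          \<and> (\<forall>j1 j2. summable (\<lambda>j3. \<Sum>j4. t j1 j2 j3 j4))
          \<and> (\<forall>j1. summable (\<lambda>j2. \<Sum>j3. \<Sum>j4. t j1 j2 j3 j4))
          \<and> summable (\<lambda>j1. \<Sum>j2. \<Sum>j3. \<Sum>j4. t j1 j2 j3 j4)
          \<and> measure M {\<omega> \<in> space M. Y \<omega> < X \<omega>}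
              = cx * cy / (Beta ax bx * Beta ay by')
                  * (\<Sum>j1. \<Sum>j2. \<Sum>j3. \<Sum>j4. t j1 j2 j3 j4)"
proof -
  define t where "t = (\<lambda>j1 j2 j3 j4 :: nat.
             p_coeff j1 by' * p_coeff j2 (cy * (ay + real j1))
               * p_coeff j3 bx * p_coeff j4 (cx * (ax + real j3))
               * (\<gamma>x * (real j4 + 1))
             / ((real j2 + 1) * (real j4 + 1)
                 * (\<gamma>x * (real j4 + 1) + \<gamma>y * (real j2 + 1))))"
  interpret prob_space M by fact
  have kernels: "integrable lborel (unit_kernel ax bx cx)" "integrable lborel (unit_kernel ay by' cy)"
    using integrable_unit_kernel[OF _ _ _ _ _ finite_measure_axioms] assms by metis+
  \<comment> \<open>Cancelling \<gamma>x (j4 + 1) brings the rational factor to the integral over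
    the region with \<rho> = \<gamma>y/\<gamma>x.\<close>
  have coeff: "\<gamma>x * (real j4 + 1)
        / ((real j2 + 1) * (real j4 + 1) * (\<gamma>x * (real j4 + 1) + \<gamma>y * (real j2 + 1)))
      = 1 / ((real j2 + 1) * (real j4 + 1 + \<gamma>y / \<gamma>x * (real j2 + 1)))" for j2 j4
  proof -
    have "\<gamma>x * (real j4 + 1) + \<gamma>y * (real j2 + 1) = \<gamma>x * (real j4 + 1 + \<gamma>y / \<gamma>x * (real j2 + 1))"
      using \<open>\<gamma>x > 0\<close> by (simp add: field_simps)
    moreover have "\<gamma>x * (real j4 + 1) \<noteq> 0"
      using \<open>\<gamma>x > 0\<close> by (simp add: add_pos_nonneg)
    moreover have "g * i / (j * i * (g * d)) = 1 / (j * d)" if "g * i \<noteq> 0" for g i j d :: real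
      using that by simp
    ultimately show ?thesis
      by metis
  qed
  have t_eq: "t = (\<lambda>j1 j2 j3 j4. p_coeff j1 by' * p_coeff j2 (cy * (ay + real j1))
      * p_coeff j3 bx * p_coeff j4 (cx * (ax + real j3))
      * (1 / ((real j2 + 1) * (real j4 + 1 + \<gamma>y / \<gamma>x * (real j2 + 1)))))"
    unfolding t_def coeff[symmetric] by (simp only: times_divide_eq_right)
  have "\<gamma>y / \<gamma>x > 0"
    using assms by simp
  note series = iterated_series[OF this \<open>ax > 0\<close> \<open>cx > 0\<close> \<open>ay > 0\<close> \<open>cy > 0\<close> kernels]
  show ?thesis
    unfolding t_def[symmetric] Let_def unfolding t_eq
    by (intro conjI allI series(1-4)) (simp only: series(5) prob_less_eq_integral[OF assms])
qed

end
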